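(* Let $(X,d)$ be a metric space, $C\subset X$ a subset, $L\ge 0$, and $g:C\to\mathbb{R}$ an $L$-Lipschitz function. Then for every $\varepsilon>0$ there exists an $(L+\varepsilon)$-Lipschitz function $f:X\to\mathbb{R}$ whose restriction to $C$ coincides with $g$ and such that $$\mathrm{lip}_a(f,x)=\mathrm{lip}_a(g,x)\qquad\text{for all }x\in C,$$ where $\mathrm{lip}_a(f,x)$ is computed relative to the domain $X$ of $f$ and $\mathrm{lip}_a(g,x)$ relative to the domain $C$ of $g$. Moreover, if $g$ is bounded, then $f$ can be chosen to be bounded; and if $g$ has bounded support, then $f$ can be chosen to have bounded support.
   Context: For a metric space $(X,d)$, a subset $D\subset X$, a function $h:D\to\mathbb{R}$ and $A\subset D$, the Lipschitz constant of $h$ on $A$ is $$\mathrm{Lip}(h,A):=\sup\Big\{\frac{|h(y_1)-h(y_2)|}{d(y_1,y_2)} : y_1,y_2\in A,\ y_1\neq y_2\Big\},$$ with the convention that the supremum is $0$ if $A$ has at most one point. The function $h$ is $L$-Lipschitz if $\mathrm{Lip}(h,D)\le L$. For $x\in D$ the asymptotic Lipschitz constant of $h$ at $x$ (relative to its domain $D$) is $$\mathrm{lip}_a(h,x):=\inf_{r>0}\mathrm{Lip}(h,D\cap B_r(x))=\lim_{r\to0}\mathrm{Lip}(h,D\cap B_r(x)),$$ where $B_r(x)$ is the ball in $X$ of radius $r$ centred at $x$. In particular $\mathrm{lip}_a(h,x)=0$ if $x$ is an isolated point of $D$. The support of $h$ is the closure in $D$ of $\{h\neq0\}$. *)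

theory Defs
  imports "HOL-Analysis.Analysis"
begin

text \<open>
  The metric space \<open>X\<close> is the universe of a type of class \<^class>\<open>metric_space\<close>. A function
  \<open>h : D \<rightarrow> \<real>\<close> is a total function together with the set \<open>D\<close>; nothing below depends on its
  values outside \<open>D\<close>.

  Lipschitz constants are suprema in \<^typ>\<open>ennreal\<close>, so they may be infinite. The supremum of the
  empty set is \<open>0\<close> there, which gives the convention for sets with at most one point.
\<close>

definition Lip :: "('a::metric_space \<Rightarrow> real) \<Rightarrow> 'a set \<Rightarrow> ennreal" where
  "Lip h A = Sup {ennreal (\<bar>h y1 - h y2\<bar> / dist y1 y2) | y1 y2. y1 \<in> A \<and> y2 \<in> A \<and> y1 \<noteq> y2}"

definition is_Lipschitz :: "real \<Rightarrow> 'a::metric_space set \<Rightarrow> ('a \<Rightarrow> real) \<Rightarrow> bool" where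
  "is_Lipschitz L D h \<longleftrightarrow> Lip h D \<le> ennreal L"

definition lip_a :: "'a::metric_space set \<Rightarrow> ('a \<Rightarrow> real) \<Rightarrow> 'a \<Rightarrow> ennreal" where
  "lip_a D h x = (INF r\<in>{0::real<..}. Lip h (D \<inter> ball x r))"

definition support_in :: "'a::metric_space set \<Rightarrow> ('a \<Rightarrow> real) \<Rightarrow> 'a set" where
  "support_in D h = D \<inter> closure {x \<in> D. h x \<noteq> 0}"

lemma Lip_at_most_one_point: "A \<subseteq> {a} \<Longrightarrow> Lip h A = 0"
proof -
  assume "A \<subseteq> {a}"
  then have "{ennreal (\<bar>h y1 - h y2\<bar> / dist y1 y2) | y1 y2. y1 \<in> A \<and> y2 \<in> A \<and> y1 \<noteq> y2} = {}"
    by blast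
  then show ?thesis
    unfolding Lip_def by (metis Sup_empty bot_ennreal)
qed

lemma Lip_mono: "A \<subseteq> B \<Longrightarrow> Lip h A \<le> Lip h B"
  unfolding Lip_def by (intro Sup_subset_mono) blast

text \<open>For \<open>L < 0\<close> the equivalence fails: \<open>ennreal L = 0\<close>.\<close>

lemma is_Lipschitz_iff_lipschitz_on:
  assumes "0 \<le> L"
  shows "is_Lipschitz L D h \<longleftrightarrow> L-lipschitz_on D h"
proof -
  have "is_Lipschitz L D h \<longleftrightarrow>
      (\<forall>y1\<in>D. \<forall>y2\<in>D. y1 \<noteq> y2 \<longrightarrow> ennreal (\<bar>h y1 - h y2\<bar> / dist y1 y2) \<le> ennreal L)"
    unfolding is_Lipschitz_def Lip_def Sup_le_iff by blast
  also have "\<dots> \<longleftrightarrow>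
      (\<forall>y1\<in>D. \<forall>y2\<in>D. y1 \<noteq> y2 \<longrightarrow> \<bar>h y1 - h y2\<bar> / dist y1 y2 \<le> L)"
    using assms by (simp add: ennreal_le_iff)
  also have "\<dots> \<longleftrightarrow> (\<forall>y1\<in>D. \<forall>y2\<in>D. dist (h y1) (h y2) \<le> L * dist y1 y2)"
    by (intro ball_cong refl) (auto simp: dist_real_def divide_le_eq)
  finally show ?thesis
    using assms by (simp add: lipschitz_on_def)
qed

lemma lip_a_tendsto: "((\<lambda>r. Lip h (D \<inter> ball x r)) \<longlongrightarrow> lip_a D h x) (at_right 0)"
proof (rule order_tendstoI)
  fix a assume a: "a < lip_a D h x"
  have "a < Lip h (D \<inter> ball x r)" if "0 < r" for r
    using a that unfolding lip_a_def by (meson INF_lower greaterThan_iff less_le_trans)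
  then show "\<forall>\<^sub>F r in at_right 0. a < Lip h (D \<inter> ball x r)"
    using eventually_at_right_less by (rule eventually_mono[rotated])
next
  fix a assume "lip_a D h x < a"
  then obtain r0 where r0: "0 < r0" "Lip h (D \<inter> ball x r0) < a"
    unfolding lip_a_def by (auto simp: INF_less_iff)
  have "Lip h (D \<inter> ball x r) < a" if "0 < r" "r < r0" for r
  proof -
    have "Lip h (D \<inter> ball x r) \<le> Lip h (D \<inter> ball x r0)"
      using that by (intro Lip_mono) auto
    then show ?thesis
      using r0 by (rule_tac le_less_trans)
  qed
  then show "\<forall>\<^sub>F r in at_right 0. Lip h (D \<inter> ball x r) < a"
    using r0(1) by (auto simp: eventually_at_right_field)
qed

end

theory Submission
  imports Defs
begin

text \<open>
  The McShane extension \<open>f z = (INF y\<in>C. g y + L * dist y z)\<close> puts a cone of slope \<open>L\<close>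
  at every point of \<open>C\<close> and therefore has slope \<open>L\<close> even where \<open>g\<close> is locally flatter. The cones
  are replaced by convex profiles whose slope near the tip \<open>y\<close> is hardly larger than the slope of \<open>g\<close>
  near \<open>y\<close>, and which grow to slope \<open>L + e\<close> at larger distances:
  \<open>f z = (INF y\<in>C. g y + profile C e g y (dist y z))\<close>.

  A point \<open>w\<close> of \<open>C\<close> at distance \<open>s\<close> from \<open>y\<close> requires that the profile of \<open>y\<close> has height at least
  \<open>\<bar>g y - g w\<bar>\<close> at \<open>s\<close>; otherwise \<open>f\<close> would be smaller than \<open>g\<close> at \<open>w\<close>. If \<open>q\<close> is the difference
  quotient of \<open>g\<close> between \<open>y\<close> and \<open>w\<close> and \<open>a = e * min 1 s\<close>, this height is provided by the ramp
  \<open>t \<mapsto> max 0 ((q + a) * t - a * s / 2)\<close>, and the profile is the supremum of these ramps. Three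
  features make this work.

  \<^item> The ramp has height \<open>q * s + a * s / 2\<close> at \<open>s\<close>, which is more than required. Hence at a
    point \<open>x\<close> of \<open>C\<close>, and in a small ball around it, the infimum is only approached by tips \<open>y\<close>
    close to \<open>x\<close>.
  \<^item> The ramp is flat up to \<open>t = a * s / (2 * (q + a))\<close>, so a distant \<open>w\<close> has no effect on the
    profile close to its tip.
  \<^item> For \<open>w\<close> close to \<open>y\<close> the slope \<open>q + a\<close> is almost \<open>q\<close>, since \<open>a\<close> tends to \<open>0\<close> with \<open>s\<close>.

  Together they show that around \<open>x \<in> C\<close> the function \<open>f\<close> is an infimum of functions whose Lipschitz
  constant is at most that of \<open>g\<close> near \<open>x\<close>, up to a small error
  (\<open>lipschitz_on_ball_extension\<close>). The inequality \<open>lip_a C g x \<le> lip_a UNIV f x\<close>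
  is clear because \<open>f\<close> extends \<open>g\<close>.

  If \<open>g\<close> is bounded by \<open>M\<close>, the function \<open>f\<close> is at least \<open>- M\<close> since profiles are nonnegative, and cutting it
  off at \<open>M\<close> from above does not increase Lipschitz constants. If \<open>g\<close> has bounded support, then \<open>g\<close> is
  first extended by \<open>0\<close> to the complement of a large ball. This costs an arbitrarily small
  increase of the Lipschitz constant, does not change \<open>lip_a\<close>, and forces \<open>f\<close> to vanish far away.
\<close>

section \<open>Asymptotic and ordinary Lipschitz constants\<close>

lemma Lip_le_iff_lipschitz_on:
  assumes "0 \<le> k"
  shows "Lip h A \<le> ennreal k \<longleftrightarrow> k-lipschitz_on A h"
  using is_Lipschitz_iff_lipschitz_on[OF assms] by (simp add: is_Lipschitz_def)

lemma Lip_cong: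
  assumes "\<And>x. x \<in> A \<Longrightarrow> h x = h' x"
  shows "Lip h A = Lip h' A"
proof -
  have "(v = ennreal (\<bar>h y1 - h y2\<bar> / dist y1 y2) \<and> y1 \<in> A \<and> y2 \<in> A \<and> y1 \<noteq> y2) \<longleftrightarrow>
      (v = ennreal (\<bar>h' y1 - h' y2\<bar> / dist y1 y2) \<and> y1 \<in> A \<and> y2 \<in> A \<and> y1 \<noteq> y2)" for v y1 y2
    using assms[of y1] assms[of y2] by (cases "y1 \<in> A \<and> y2 \<in> A") auto
  then show ?thesis
    by (simp only: Lip_def)
qed

lemma lip_a_mono:
  assumes "C \<subseteq> D" "\<And>x. x \<in> C \<Longrightarrow> f x = g x"
  shows "lip_a C g x \<le> lip_a D f x"
  unfolding lip_a_def
proof (rule INF_mono')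
  fix r
  have "Lip g (C \<inter> ball x r) = Lip f (C \<inter> ball x r)"
    using assms(2) by (intro Lip_cong) auto
  also have "\<dots> \<le> Lip f (D \<inter> ball x r)"
    using assms(1) by (intro Lip_mono) auto
  finally show "Lip g (C \<inter> ball x r) \<le> Lip f (D \<inter> ball x r)" .
qed

lemma lip_a_less_imp_lipschitz_on:
  assumes "lip_a D h x < ennreal k" "0 \<le> k"
  obtains r where "0 < r" "k-lipschitz_on (D \<inter> ball x r) h"
proof -
  obtain r where r: "0 < r" "Lip h (D \<inter> ball x r) < ennreal k"
    using assms(1) unfolding lip_a_def by (auto simp: INF_less_iff)
  then have "k-lipschitz_on (D \<inter> ball x r) h"
    using Lip_le_iff_lipschitz_on[OF assms(2)] less_imp_le by blast
  with r show ?thesis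
    using that by blast
qed

lemma lip_a_le_if_lipschitz_on:
  assumes "0 < r" "k-lipschitz_on (D \<inter> ball x r) h"
  shows "lip_a D h x \<le> ennreal k"
proof -
  have "0 \<le> k"
    using assms(2) by (rule lipschitz_on_nonneg)
  then have "Lip h (D \<inter> ball x r) \<le> ennreal k"
    using Lip_le_iff_lipschitz_on assms(2) by blast
  moreover have "lip_a D h x \<le> Lip h (D \<inter> ball x r)"
    unfolding lip_a_def using assms(1) by (intro INF_lower) auto
  ultimately show ?thesis
    by simp
qed

lemma lip_a_le_lip_aI:
  assumes fin: "lip_a C g x < \<infinity>"
    and step: "\<And>k \<rho> \<eta>. 0 < \<rho> \<Longrightarrow> k-lipschitz_on (C \<inter> ball x \<rho>) g \<Longrightarrow> 0 < \<eta> \<Longrightarrow>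
      \<exists>r>0. (k + \<eta>)-lipschitz_on (D \<inter> ball x r) f"
  shows "lip_a D f x \<le> lip_a C g x"
proof -
  obtain m where m: "0 \<le> m" "lip_a C g x = ennreal m"
    using fin by (cases "lip_a C g x") auto
  have "lip_a D f x \<le> ennreal m"
  proof (rule ennreal_le_epsilon)
    fix \<eta> :: real assume \<eta>: "0 < \<eta>"
    have "lip_a C g x < ennreal (m + \<eta> / 2)"
      using m \<eta> by (simp add: ennreal_less_iff)
    then obtain \<rho> where "0 < \<rho>" "(m + \<eta> / 2)-lipschitz_on (C \<inter> ball x \<rho>) g"
      using m \<eta> lip_a_less_imp_lipschitz_on[of C g x "m + \<eta> / 2"] by auto
    then obtain r where "0 < r" "(m + \<eta> / 2 + \<eta> / 2)-lipschitz_on (D \<inter> ball x r) f"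
      using step \<eta> half_gt_zero by blast
    then have "lip_a D f x \<le> ennreal (m + \<eta> / 2 + \<eta> / 2)"
      by (rule lip_a_le_if_lipschitz_on)
    also have "\<dots> = ennreal m + ennreal \<eta>"
      using m \<eta> by (simp flip: ennreal_plus)
    finally show "lip_a D f x \<le> ennreal m + ennreal \<eta>" .
  qed
  then show ?thesis
    using m by simp
qed

lemma lip_a_finite:
  assumes "L-lipschitz_on D h"
  shows "lip_a D h x < \<infinity>"
proof -
  have "L-lipschitz_on (D \<inter> ball x 1) h"
    using assms by (rule lipschitz_on_subset) auto
  then have "lip_a D h x \<le> ennreal L"
    by (intro lip_a_le_if_lipschitz_on[of 1]) auto
  then show ?thesis
    using le_less_trans[OF _ ennreal_less_top] by simp
qed

lemma lip_a_cong_ball: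
  assumes "0 < r" "C \<inter> ball x r = D \<inter> ball x r"
    and "\<And>y. y \<in> C \<inter> ball x r \<Longrightarrow> g y = h y"
  shows "lip_a C g x = lip_a D h x"
proof -
  have eq: "Lip g (C \<inter> ball x t) = Lip h (D \<inter> ball x t)" if "t \<le> r" for t
  proof -
    have "C \<inter> ball x t = D \<inter> ball x t"
      using assms(2) subset_ball[OF that, of x] by blast
    moreover have "Lip g (C \<inter> ball x t) = Lip h (C \<inter> ball x t)"
      using assms(3) that by (intro Lip_cong) auto
    ultimately show ?thesis
      by simp
  qed
  have "\<forall>\<^sub>F t in at_right 0. Lip g (C \<inter> ball x t) = Lip h (D \<inter> ball x t)"
    unfolding eventually_at_right_field using assms(1) eq by (intro exI[of _ r]) simp
  then have "((\<lambda>t. Lip g (C \<inter> ball x t)) \<longlongrightarrow> lip_a D h x) (at_right 0)"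
    using lip_a_tendsto[of h D x] by (simp only: tendsto_cong)
  with lip_a_tendsto[of g C x] show ?thesis
    by (rule tendsto_unique[OF trivial_limit_at_right_real])
qed

lemma lipschitz_on_SUP:
  fixes h :: "'i \<Rightarrow> 'b::metric_space \<Rightarrow> real"
  assumes "I \<noteq> {}" and lip: "\<And>i. i \<in> I \<Longrightarrow> k-lipschitz_on A (h i)"
    and bdd: "\<And>t. t \<in> A \<Longrightarrow> bdd_above ((\<lambda>i. h i t) ` I)"
  shows "k-lipschitz_on A (\<lambda>t. SUP i\<in>I. h i t)"
proof (rule lipschitz_onI)
  show "0 \<le> k"
    using assms(1) lip lipschitz_on_nonneg by blast
  have le: "(SUP i\<in>I. h i s) \<le> (SUP i\<in>I. h i t) + k * dist s t" if "s \<in> A" "t \<in> A" for s t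
  proof (rule cSUP_least[OF assms(1)])
    fix i assume i: "i \<in> I"
    have "h i s \<le> h i t + k * dist s t"
      using lipschitz_onD[OF lip[OF i] that] by (simp add: dist_real_def)
    also have "h i t \<le> (SUP i\<in>I. h i t)"
      using i bdd[OF that(2)] by (rule cSUP_upper)
    finally show "h i s \<le> (SUP i\<in>I. h i t) + k * dist s t" by simp
  qed
  show "dist (SUP i\<in>I. h i s) (SUP i\<in>I. h i t) \<le> k * dist s t" if "s \<in> A" "t \<in> A" for s t
    using le[OF that] le[OF that(2,1)] by (simp add: dist_real_def dist_commute abs_le_iff)
qed

lemma lipschitz_on_min_const:
  fixes h :: "'b::metric_space \<Rightarrow> real"
  assumes "k-lipschitz_on A h"
  shows "k-lipschitz_on A (\<lambda>z. min (h z) M)"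
proof (rule lipschitz_onI)
  show "0 \<le> k"
    using assms by (rule lipschitz_on_nonneg)
  show "dist (min (h s) M) (min (h t) M) \<le> k * dist s t" if "s \<in> A" "t \<in> A" for s t
    using lipschitz_onD[OF assms that] by (simp add: dist_real_def min_def abs_le_iff split: if_splits)
qed

section \<open>The profiles\<close>

definition surcharge :: "real \<Rightarrow> 'a::metric_space \<Rightarrow> 'a \<Rightarrow> real" where
  "surcharge e y w = e * min 1 (dist y w)"

text \<open>For \<open>w = y\<close> both the quotient (as \<open>0 / 0 = 0\<close>) and the surcharge vanish, so that the ramp of \<open>y\<close>
  itself is \<open>0\<close>.\<close>

definition slope :: "real \<Rightarrow> ('a::metric_space \<Rightarrow> real) \<Rightarrow> 'a \<Rightarrow> 'a \<Rightarrow> real" where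
  "slope e g y w = \<bar>g y - g w\<bar> / dist y w + surcharge e y w"

definition ramp :: "real \<Rightarrow> ('a::metric_space \<Rightarrow> real) \<Rightarrow> 'a \<Rightarrow> 'a \<Rightarrow> real \<Rightarrow> real" where
  "ramp e g y w t = max 0 (slope e g y w * t - surcharge e y w * dist y w / 2)"

definition profile :: "'a::metric_space set \<Rightarrow> real \<Rightarrow> ('a \<Rightarrow> real) \<Rightarrow> 'a \<Rightarrow> real \<Rightarrow> real" where
  "profile C e g y t = (SUP w\<in>C. ramp e g y w t)"

definition extension :: "'a::metric_space set \<Rightarrow> real \<Rightarrow> ('a \<Rightarrow> real) \<Rightarrow> 'a \<Rightarrow> real" where
  "extension C e g z = (INF y\<in>C. g y + profile C e g y (dist y z))"

lemma ramp_lipschitz: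
  assumes "0 \<le> slope e g y w" "slope e g y w \<le> k"
  shows "k-lipschitz_on A (ramp e g y w)"
proof (rule lipschitz_onI)
  show "0 \<le> k" using assms by simp
  fix s t
  let ?m = "slope e g y w"
  have "\<bar>ramp e g y w s - ramp e g y w t\<bar> \<le> \<bar>?m * s - ?m * t\<bar>"
    unfolding ramp_def by linarith
  also have "\<dots> = ?m * \<bar>s - t\<bar>"
    using assms(1) by (simp add: abs_mult flip: right_diff_distrib)
  also have "\<dots> \<le> k * \<bar>s - t\<bar>"
    using assms(2) by (intro mult_right_mono) auto
  finally show "dist (ramp e g y w s) (ramp e g y w t) \<le> k * dist s t"
    by (simp add: dist_real_def)
qed

context
  fixes C :: "'a::metric_space set" and g :: "'a \<Rightarrow> real" and L e :: real
  assumes lip: "L-lipschitz_on C g" and e: "0 < e"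
begin

lemma L_nonneg: "0 \<le> L"
  using lip by (rule lipschitz_on_nonneg)

lemma surcharge_nonneg: "0 \<le> surcharge e y w"
  using e by (simp add: surcharge_def)

lemma gap_nonneg: "0 \<le> surcharge e y w * dist y w / 2"
  using surcharge_nonneg by (intro divide_nonneg_pos mult_nonneg_nonneg) auto

lemma slope_nonneg: "0 \<le> slope e g y w"
  by (simp add: slope_def surcharge_nonneg)

lemma slope_le_of_lipschitz_on:
  assumes "k-lipschitz_on A g" "y \<in> A" "w \<in> A"
  shows "slope e g y w \<le> k + surcharge e y w"
  using lipschitz_onD[OF assms] lipschitz_on_nonneg[OF assms(1)]
  by (simp add: slope_def dist_real_def divide_le_eq)

lemma slope_le:
  assumes "y \<in> C" "w \<in> C"
  shows "slope e g y w \<le> L + e"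
proof -
  have "surcharge e y w \<le> e"
    using e by (simp add: surcharge_def mult_left_le)
  then show ?thesis
    using slope_le_of_lipschitz_on[OF lip assms] by simp
qed

lemma ramp_le:
  assumes "y \<in> C" "w \<in> C" "0 \<le> t"
  shows "ramp e g y w t \<le> (L + e) * t"
proof -
  have "slope e g y w * t \<le> (L + e) * t"
    using slope_le[OF assms(1,2)] assms(3) by (rule mult_right_mono)
  moreover have "0 \<le> surcharge e y w * dist y w / 2"
    by (rule gap_nonneg)
  moreover have "0 \<le> (L + e) * t"
    using L_nonneg e assms(3) by simp
  ultimately show ?thesis
    unfolding ramp_def by linarith
qed

lemma bdd_above_ramp:
  assumes "y \<in> C" "0 \<le> t"
  shows "bdd_above ((\<lambda>w. ramp e g y w t) ` C)"
  using ramp_le assms by (intro bdd_aboveI2) blast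

lemma ramp_le_profile:
  assumes "y \<in> C" "w \<in> C" "0 \<le> t"
  shows "ramp e g y w t \<le> profile C e g y t"
  unfolding profile_def using bdd_above_ramp assms by (intro cSUP_upper) auto

lemma profile_le:
  assumes "y \<in> C" "0 \<le> t"
  shows "profile C e g y t \<le> (L + e) * t"
  unfolding profile_def using ramp_le assms by (intro cSUP_least) auto

lemma profile_nonneg:
  assumes "y \<in> C" "0 \<le> t"
  shows "0 \<le> profile C e g y t"
  using ramp_le_profile[OF assms(1) assms(1) assms(2)] by (simp add: ramp_def)

text \<open>Up to distance \<open>T\<close> from the tip only those ramps matter that have started to rise before \<open>T\<close>.\<close>

lemma profile_lipschitz_on:
  assumes y: "y \<in> C" and "0 \<le> k"
    and steep: "\<And>w. w \<in> C \<Longrightarrow> slope e g y w \<le> k \<or> (L + e) * T \<le> surcharge e y w * dist y w / 2"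
  shows "k-lipschitz_on {0..T} (profile C e g y)"
proof -
  have "k-lipschitz_on {0..T} (ramp e g y w)" if w: "w \<in> C" for w
    using steep[OF w]
  proof
    assume "slope e g y w \<le> k"
    then show ?thesis
      using slope_nonneg by (intro ramp_lipschitz)
  next
    assume late: "(L + e) * T \<le> surcharge e y w * dist y w / 2"
    have "ramp e g y w t = 0" if "t \<in> {0..T}" for t
    proof -
      have "slope e g y w * t \<le> (L + e) * T"
        using slope_le[OF y w] that L_nonneg e by (intro mult_mono) auto
      then show ?thesis
        using late by (simp add: ramp_def)
    qed
    then show ?thesis
      using \<open>0 \<le> k\<close> by (intro lipschitz_onI) auto
  qed
  then show ?thesis
    unfolding profile_def[abs_def] using y bdd_above_ramp[OF y]
    by (intro lipschitz_on_SUP) auto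
qed

lemma profile_lipschitz_on_nonneg:
  assumes y: "y \<in> C"
  shows "(L + e)-lipschitz_on {0..} (profile C e g y)"
  unfolding profile_def[abs_def]
  using y bdd_above_ramp[OF y] slope_nonneg slope_le[OF y]
  by (intro lipschitz_on_SUP ramp_lipschitz) auto

text \<open>The summand beyond \<open>g x\<close> is the gap that keeps distant tips \<open>y\<close> from competing at \<open>x\<close>.\<close>

lemma gap_at_point:
  assumes "y \<in> C" "x \<in> C"
  shows "g x + surcharge e y x * dist y x / 2 \<le> g y + profile C e g y (dist y x)"
proof -
  have "g x - g y + surcharge e y x * dist y x / 2 \<le>
      slope e g y x * dist y x - surcharge e y x * dist y x / 2"
    by (cases "y = x") (auto simp: slope_def algebra_simps)
  also have "\<dots> \<le> ramp e g y x (dist y x)"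
    by (simp add: ramp_def)
  also have "\<dots> \<le> profile C e g y (dist y x)"
    using assms by (intro ramp_le_profile) auto
  finally show ?thesis by simp
qed

lemma gap_near_point:
  assumes "y \<in> C" "x \<in> C"
  shows "g x + surcharge e y x * dist y x / 2 - (L + e) * dist x z
    \<le> g y + profile C e g y (dist y z)"
proof -
  have "\<bar>profile C e g y (dist y x) - profile C e g y (dist y z)\<bar> \<le> (L + e) * \<bar>dist y x - dist y z\<bar>"
    using lipschitz_onD[OF profile_lipschitz_on_nonneg[OF assms(1)], of "dist y x" "dist y z"]
    by (simp add: dist_real_def)
  also have "\<dots> \<le> (L + e) * dist x z"
    using L_nonneg e dist_triangle[of y x z] dist_triangle[of y z x]
    by (intro mult_left_mono) (auto simp: abs_le_iff dist_commute)
  finally show ?thesis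
    using gap_at_point[OF assms] by linarith
qed

section \<open>The extension\<close>

lemma bdd_below_extension: "bdd_below ((\<lambda>y. g y + profile C e g y (dist y z)) ` C)"
proof (cases "C = {}")
  case False
  then obtain x where x: "x \<in> C" by blast
  have "g x - (L + e) * dist x z \<le> g y + profile C e g y (dist y z)" if "y \<in> C" for y
  proof -
    show ?thesis
      using gap_near_point[OF that x, of z] gap_nonneg[of y x] by linarith
  qed
  then show ?thesis
    by (intro bdd_belowI2) auto
qed simp

lemma extension_le:
  assumes "y \<in> C"
  shows "extension C e g z \<le> g y + profile C e g y (dist y z)"
  unfolding extension_def using bdd_below_extension assms by (rule cINF_lower)

lemma extension_near_minimizer:
  assumes "C \<noteq> {}" "0 < d"
  obtains y where "y \<in> C" "g y + profile C e g y (dist y z) < extension C e g z + d"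
proof -
  have "(INF y\<in>C. g y + profile C e g y (dist y z)) < extension C e g z + d"
    using assms(2) by (simp add: extension_def)
  then show ?thesis
    using that by (auto simp: cINF_less_iff[OF assms(1) bdd_below_extension])
qed

lemma extension_eq:
  assumes x: "x \<in> C"
  shows "extension C e g x = g x"
proof (rule antisym)
  have "profile C e g x 0 = 0"
    using profile_le[OF x, of 0] profile_nonneg[OF x, of 0] by simp
  then show "extension C e g x \<le> g x"
    using extension_le[OF x, of x] by simp
  show "g x \<le> extension C e g x"
    unfolding extension_def
  proof (rule cINF_greatest)
    show "C \<noteq> {}" using x by blast
    fix y assume y: "y \<in> C"
    show "g x \<le> g y + profile C e g y (dist y x)"
      using gap_at_point[OF y x] gap_nonneg[of y x] by linarith
  qed
qed

text \<open>For the Lipschitz constant on \<open>A\<close>, only the profiles of tips \<open>y\<close> matter that come within \<open>d\<close> of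
  the infimum at a point of \<open>A\<close>.\<close>

lemma extension_lipschitz_onI:
  assumes "C \<noteq> {}" "0 \<le> k" "0 < d"
    and near: "\<And>y u v. y \<in> C \<Longrightarrow> u \<in> A \<Longrightarrow> v \<in> A \<Longrightarrow>
      g y + profile C e g y (dist y v) < extension C e g v + d \<Longrightarrow>
      profile C e g y (dist y u) \<le> profile C e g y (dist y v) + k * dist u v"
  shows "k-lipschitz_on A (extension C e g)"
proof (rule lipschitz_onI)
  have le: "extension C e g u \<le> extension C e g v + k * dist u v" if A: "u \<in> A" "v \<in> A" for u v
  proof (rule field_le_epsilon)
    fix c :: real assume "0 < c"
    then obtain y where y: "y \<in> C"
      "g y + profile C e g y (dist y v) < extension C e g v + min c d"
      using extension_near_minimizer[OF assms(1), of "min c d"] \<open>0 < d\<close> by auto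
    then have "profile C e g y (dist y u) \<le> profile C e g y (dist y v) + k * dist u v"
      using near[OF y(1) A] by simp
    then show "extension C e g u \<le> extension C e g v + k * dist u v + c"
      using extension_le[OF y(1), of u] y(2) by simp
  qed
  show "dist (extension C e g u) (extension C e g v) \<le> k * dist u v" if "u \<in> A" "v \<in> A" for u v
    using le[OF that] le[OF that(2,1)] by (simp add: dist_real_def dist_commute abs_le_iff)
qed (fact \<open>0 \<le> k\<close>)

lemma profile_dist_le:
  assumes "k-lipschitz_on S (profile C e g y)" "dist y u \<in> S" "dist y v \<in> S"
  shows "profile C e g y (dist y u) \<le> profile C e g y (dist y v) + k * dist u v"
proof -
  have "profile C e g y (dist y u) - profile C e g y (dist y v) \<le> k * \<bar>dist y u - dist y v\<bar>"
    using lipschitz_onD[OF assms] by (simp add: dist_real_def)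
  also have "\<dots> \<le> k * dist u v"
    using lipschitz_on_nonneg[OF assms(1)] dist_triangle[of y u v] dist_triangle[of y v u]
    by (intro mult_left_mono) (auto simp: abs_le_iff dist_commute)
  finally show ?thesis by simp
qed

lemma extension_lipschitz:
  assumes "C \<noteq> {}"
  shows "(L + e)-lipschitz_on UNIV (extension C e g)"
  using assms L_nonneg e profile_lipschitz_on_nonneg
  by (intro extension_lipschitz_onI[of _ 1] profile_dist_le[of _ "{0..}"]) auto

text \<open>Three scales are used around \<open>x\<close>. Within distance \<open>\<tau>\<close> of a tip close to \<open>x\<close>, all slopes are at most
  \<open>k + \<eta>\<close>. Ramps caused by points farther than \<open>\<tau>\<close> away are still flat at distance
  \<open>2 * R\<close>. Finally, in the ball of radius \<open>r\<close> around \<open>x\<close>, tips farther than \<open>R\<close> from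
  \<open>x\<close> do not come close to the infimum.\<close>

lemma lipschitz_on_ball_extension:
  assumes x: "x \<in> C" and \<rho>: "0 < \<rho>" and k: "k-lipschitz_on (C \<inter> ball x \<rho>) g" and \<eta>: "0 < \<eta>"
  shows "\<exists>r>0. (k + \<eta>)-lipschitz_on (ball x r) (extension C e g)"
proof -
  define K where "K = L + e"
  have K: "0 < K"
    using L_nonneg e by (simp add: K_def)
  have k0: "0 \<le> k"
    using k by (rule lipschitz_on_nonneg)
  define \<tau> where "\<tau> = min (\<rho> / 2) (min 1 (\<eta> / e))"
  have \<tau>: "0 < \<tau>" "\<tau> \<le> \<rho> / 2" "\<tau> \<le> 1" "\<tau> \<le> \<eta> / e"
    using \<rho> \<eta> e unfolding \<tau>_def by (simp, linarith+)
  define R where "R = min \<tau> (e * \<tau>\<^sup>2 / (4 * K))"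
  have R: "0 < R" "R \<le> \<tau>" "R \<le> e * \<tau>\<^sup>2 / (4 * K)"
    using \<tau> e K by (auto simp: R_def)
  have KR: "K * (2 * R) \<le> e * \<tau>\<^sup>2 / 2"
    using R(3) K by (simp add: field_simps)
  define r where "r = min R (e * R\<^sup>2 / (6 * K))"
  have r: "0 < r" "r \<le> R" "r \<le> e * R\<^sup>2 / (6 * K)"
    using R e K by (auto simp: r_def)
  have Kr: "3 * (K * r) \<le> e * R\<^sup>2 / 2"
    using r(3) K by (simp add: field_simps)
  have far: "e * c\<^sup>2 / 2 \<le> surcharge e y w * dist y w / 2" if "c \<le> dist y w" "0 \<le> c" "c \<le> 1" for c y w
  proof -
    have "e * (c * c) \<le> e * (min 1 (dist y w) * dist y w)"
      using that e by (intro mult_left_mono mult_mono) auto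
    then show ?thesis
      by (simp add: surcharge_def power2_eq_square mult.assoc)
  qed
  have flat: "(k + \<eta>)-lipschitz_on {0..2 * R} (profile C e g y)" if y: "y \<in> C" "dist x y < R" for y
  proof (rule profile_lipschitz_on)
    fix w assume w: "w \<in> C"
    show "slope e g y w \<le> k + \<eta> \<or> (L + e) * (2 * R) \<le> surcharge e y w * dist y w / 2"
    proof (cases "dist y w < \<tau>")
      case True
      have "dist x w < \<rho>"
        using True y(2) R(2) \<tau>(2) dist_triangle[of x w y] by linarith
      moreover have "dist x y < \<rho>"
        using y(2) R(2) \<tau>(2) \<rho> by linarith
      ultimately have "slope e g y w \<le> k + surcharge e y w"
        using y w by (intro slope_le_of_lipschitz_on[OF k]) auto
      also have "surcharge e y w \<le> e * \<tau>"
        unfolding surcharge_def using True e by (intro mult_left_mono) auto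
      also have "\<dots> \<le> \<eta>"
        using \<tau>(4) e by (simp add: field_simps)
      finally show ?thesis by simp
    next
      case False
      then show ?thesis
        using far[of \<tau> y w] KR \<tau> by (simp add: K_def)
    qed
  qed (use y k0 \<eta> in auto)
  have tips: "dist x y < R"
    if y: "y \<in> C" and v: "v \<in> ball x r"
      and lt: "g y + profile C e g y (dist y v) < extension C e g v + K * r" for y v
  proof (rule ccontr)
    assume "\<not> dist x y < R"
    then have "e * R\<^sup>2 / 2 \<le> surcharge e y x * dist y x / 2"
      using R \<tau> by (intro far) (auto simp: dist_commute)
    then have "g x + e * R\<^sup>2 / 2 - K * dist x v \<le> g y + profile C e g y (dist y v)"
      using gap_near_point[OF y x, of v] by (simp add: K_def)
    moreover have "extension C e g v \<le> g x + K * dist x v"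
      using extension_le[OF x, of v] profile_le[OF x, of "dist x v"] by (simp add: K_def)
    moreover have "K * dist x v < K * r"
      using v K by (simp add: mult_strict_left_mono)
    ultimately show False
      using lt Kr by linarith
  qed
  have "(k + \<eta>)-lipschitz_on (ball x r) (extension C e g)"
  proof (rule extension_lipschitz_onI)
    fix y u v
    assume y: "y \<in> C" and u: "u \<in> ball x r" and v: "v \<in> ball x r"
      and lt: "g y + profile C e g y (dist y v) < extension C e g v + K * r"
    have "dist x y < R"
      using y v lt by (rule tips)
    moreover have "dist y u \<le> 2 * R" "dist y v \<le> 2 * R"
      using \<open>dist x y < R\<close> u v r(2) dist_triangle[of y u x] dist_triangle[of y v x]
      by (auto simp: dist_commute)
    ultimately show "profile C e g y (dist y u) \<le> profile C e g y (dist y v) + (k + \<eta>) * dist u v"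
      using y by (intro profile_dist_le[OF flat]) auto
  qed (use x k0 \<eta> K r in auto)
  then show ?thesis
    using r(1) by blast
qed

lemma extension_ge:
  assumes "C \<noteq> {}" "\<And>y. y \<in> C \<Longrightarrow> c \<le> g y"
  shows "c \<le> extension C e g z"
  unfolding extension_def
proof (rule cINF_greatest[OF assms(1)])
  fix y assume "y \<in> C"
  then show "c \<le> g y + profile C e g y (dist y z)"
    using assms(2)[of y] profile_nonneg[of y "dist y z"] by simp
qed

text \<open>The extension is bounded below if \<open>g\<close> is, so only the upper bound has to be enforced.\<close>

lemma lipschitz_extension_preserving_lip_a:
  "\<exists>f. (L + e)-lipschitz_on UNIV f \<and> (\<forall>x\<in>C. f x = g x) \<and>
    (\<forall>x\<in>C. lip_a UNIV f x = lip_a C g x) \<and> (bounded (g ` C) \<longrightarrow> bounded (range f))"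
proof (cases "C = {}")
  case True
  have "(L + e)-lipschitz_on UNIV (\<lambda>_::'a. 0::real)"
    using L_nonneg e by (intro lipschitz_onI) auto
  then show ?thesis
    using True by (intro exI[of _ "\<lambda>_. 0"]) auto
next
  case False
  have extension_lip_a: "lip_a UNIV f x = lip_a C g x"
    if f: "\<And>x. x \<in> C \<Longrightarrow> f x = g x" and x: "x \<in> C"
      and le: "\<And>k A. k-lipschitz_on A (extension C e g) \<Longrightarrow> k-lipschitz_on A f" for f x
  proof (rule antisym)
    show "lip_a C g x \<le> lip_a UNIV f x"
      using f by (intro lip_a_mono) auto
    show "lip_a UNIV f x \<le> lip_a C g x"
    proof (rule lip_a_le_lip_aI[OF lip_a_finite[OF lip]])
      fix k \<rho> \<eta> :: real
      assume "0 < \<rho>" "k-lipschitz_on (C \<inter> ball x \<rho>) g" "0 < \<eta>"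
      then show "\<exists>r>0. (k + \<eta>)-lipschitz_on (UNIV \<inter> ball x r) f"
        using lipschitz_on_ball_extension[OF x] le by force
    qed
  qed
  show ?thesis
  proof (cases "bounded (g ` C)")
    case unbounded: False
    then show ?thesis
      using extension_lipschitz[OF False] extension_eq extension_lip_a
      by (intro exI[of _ "extension C e g"]) auto
  next
    case True
    then obtain M where M: "\<And>y. y \<in> C \<Longrightarrow> \<bar>g y\<bar> \<le> M"
      by (auto simp: bounded_iff)
    define f where "f z = min (extension C e g z) M" for z
    have lip_f: "k-lipschitz_on A f" if "k-lipschitz_on A (extension C e g)" for k A
      unfolding f_def[abs_def] using that by (rule lipschitz_on_min_const)
    have f: "f x = g x" if "x \<in> C" for x
      using M[OF that] extension_eq[OF that] by (simp add: f_def)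
    have "- M \<le> extension C e g z" for z
    proof (rule extension_ge[OF False])
      show "- M \<le> g y" if "y \<in> C" for y
        using M[OF that] by linarith
    qed
    moreover have "0 \<le> M"
      using M False abs_ge_zero order_trans by blast
    ultimately have "\<bar>f z\<bar> \<le> M" for z
      by (auto simp: f_def abs_le_iff min_def minus_le_iff)
    then have "bounded (range f)"
      by (auto simp: bounded_iff)
    then show ?thesis
      using lip_f[OF extension_lipschitz[OF False]] f extension_lip_a[OF f _ lip_f]
      by (intro exI[of _ f]) auto
  qed
qed

end

section \<open>Bounded support\<close>

text \<open>The radius of the ball is chosen such that its complement \<open>F\<close> has distance at least \<open>1\<close> from
  \<open>{g \<noteq> 0}\<close>, hence \<open>lip_a\<close> vanishes at the points of \<open>C \<inter> F\<close> before and after the extension by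
  \<open>0\<close>, and such that going from \<open>{g \<noteq> 0}\<close> to \<open>F\<close> with slope \<open>e\<close> suffices to descend from the bound \<open>M\<close>
  of \<open>\<bar>g\<bar>\<close> to \<open>0\<close>.\<close>

lemma extend_by_zero_far_away:
  fixes C :: "'a::metric_space set" and g :: "'a \<Rightarrow> real"
  assumes lip: "L-lipschitz_on C g" and e: "0 < e" and supp: "bounded (support_in C g)"
  shows "\<exists>F h. bounded (- F) \<and> closed F \<and> (L + e)-lipschitz_on (C \<union> F) h \<and>
    (\<forall>x\<in>C. h x = g x) \<and> (\<forall>x\<in>F. h x = 0) \<and> (\<forall>x\<in>C. lip_a (C \<union> F) h x = lip_a C g x)"
proof -
  let ?S = "{x \<in> C. g x \<noteq> 0}"
  have S: "bounded ?S"
    using supp closure_subset[of ?S] by (auto simp: support_in_def elim!: bounded_subset)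
  obtain a D where D: "\<And>x. x \<in> ?S \<Longrightarrow> dist a x \<le> D"
    using S unfolding bounded_def by blast
  have L: "0 \<le> L"
    using lip by (rule lipschitz_on_nonneg)
  obtain M where M: "\<And>x. x \<in> ?S \<Longrightarrow> \<bar>g x\<bar> \<le> M"
  proof (cases "?S = {}")
    case False
    then obtain p where p: "p \<in> ?S" by blast
    have "\<bar>g x\<bar> \<le> \<bar>g p\<bar> + L * (2 * D)" if x: "x \<in> ?S" for x
    proof -
      have "\<bar>g x - g p\<bar> \<le> L * dist x p"
        using lipschitz_onD[OF lip, of x p] x p by (simp add: dist_real_def)
      also have "\<dots> \<le> L * (2 * D)"
        using L D[OF x] D[OF p] dist_triangle[of x p a] by (intro mult_left_mono) (auto simp: dist_commute)
      finally show ?thesis by linarith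
    qed
    then show ?thesis
      by (rule that)
  qed (use that in blast)
  define F where "F = - ball a (D + 1 + \<bar>M\<bar> / e)"
  define h where "h x = (if x \<in> C then g x else 0)" for x
  have dist_F: "1 + \<bar>M\<bar> / e \<le> dist x y" if "x \<in> ?S" "y \<in> F" for x y
    using D[OF that(1)] that(2) dist_triangle[of a y x] by (auto simp: F_def)
  have g_F: "g x = 0" if "x \<in> C" "x \<in> F" for x
  proof (rule ccontr)
    assume "g x \<noteq> 0"
    then have "1 + \<bar>M\<bar> / e \<le> dist x x"
      using that by (intro dist_F) auto
    moreover have "0 \<le> \<bar>M\<bar> / e"
      using e by simp
    ultimately show False
      by simp
  qed
  have h_F: "h x = 0" if "x \<in> F" for x
    using that g_F by (simp add: h_def)
  have descent: "\<bar>h x\<bar> \<le> (L + e) * dist x y" if "x \<in> C \<union> F" "y \<in> F" for x y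
  proof (cases "x \<in> ?S")
    case True
    have "\<bar>h x\<bar> \<le> \<bar>M\<bar>"
      using True M[OF True] by (simp add: h_def)
    also have "\<dots> = e * (\<bar>M\<bar> / e)"
      using e by simp
    also have "\<dots> \<le> (L + e) * dist x y"
      using dist_F[OF True that(2)] e L by (intro mult_mono) auto
    finally show ?thesis .
  next
    case False
    then have "h x = 0"
      using that by (auto simp: h_def)
    then show ?thesis
      using L e by simp
  qed
  have "(L + e)-lipschitz_on (C \<union> F) h"
  proof (rule lipschitz_onI)
    fix x y assume xy: "x \<in> C \<union> F" "y \<in> C \<union> F"
    consider "x \<in> C" "y \<in> C" | "y \<in> F" | "x \<in> F"
      using xy by blast
    then show "dist (h x) (h y) \<le> (L + e) * dist x y"
    proof cases
      case 1
      then have "dist (h x) (h y) \<le> L * dist x y"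
        using lipschitz_onD[OF lip] by (simp add: h_def)
      also have "\<dots> \<le> (L + e) * dist x y"
        using e by (intro mult_right_mono) auto
      finally show ?thesis .
    next
      case 2
      then show ?thesis
        using descent[OF xy(1) 2] h_F by (simp add: dist_real_def)
    next
      case 3
      then show ?thesis
        using descent[OF xy(2) 3] h_F by (simp add: dist_real_def dist_commute)
    qed
  qed (use L e in auto)
  moreover have "lip_a (C \<union> F) h x = lip_a C g x" if x: "x \<in> C" for x
  proof (cases "x \<in> F")
    case True
    have zero: "h y = 0 \<and> (y \<in> C \<longrightarrow> g y = 0)" if y: "y \<in> ball x 1" for y
    proof -
      have "y \<notin> ?S"
      proof
        assume "y \<in> ?S"
        then have "1 + \<bar>M\<bar> / e \<le> dist y x"
          using True by (rule dist_F)
        moreover have "0 \<le> \<bar>M\<bar> / e"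
          using e by simp
        ultimately show False
          using y by (simp add: dist_commute)
      qed
      then show ?thesis
        by (auto simp: h_def)
    qed
    have "lip_a (C \<union> F) h x \<le> ennreal 0"
      by (rule lip_a_le_if_lipschitz_on[of 1]) (auto intro!: lipschitz_onI simp: zero)
    moreover have "lip_a C g x \<le> ennreal 0"
      by (rule lip_a_le_if_lipschitz_on[of 1]) (auto intro!: lipschitz_onI simp: zero)
    ultimately show ?thesis
      by simp
  next
    case False
    have "open (- F)"
      by (simp add: F_def)
    then obtain r where r: "0 < r" "ball x r \<subseteq> - F"
      using False by (meson ComplI openE)
    then show ?thesis
      by (intro lip_a_cong_ball[of r]) (auto simp: h_def)
  qed
  moreover have "bounded (- F)" "closed F"
    by (auto simp: F_def)
  moreover have "\<forall>x\<in>C. h x = g x"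
    by (simp add: h_def)
  ultimately show ?thesis
    using h_F by blast
qed

theorem theorem1p1:
  fixes C :: "'a::metric_space set" and g :: "'a \<Rightarrow> real" and L :: real
  assumes "0 \<le> L"
    and "is_Lipschitz L C g"
  shows "\<forall>\<epsilon>>0. \<exists>f :: 'a \<Rightarrow> real.
      is_Lipschitz (L + \<epsilon>) UNIV f \<and>
      (\<forall>x\<in>C. f x = g x) \<and>
      (\<forall>x\<in>C. lip_a UNIV f x = lip_a C g x) \<and>
      (bounded (g ` C) \<longrightarrow> bounded (range f)) \<and>
      (bounded (support_in C g) \<longrightarrow> bounded (support_in UNIV f))"
proof (intro allI impI)
  fix \<epsilon> :: real assume \<epsilon>: "0 < \<epsilon>"
  have lip: "L-lipschitz_on C g"
    using assms is_Lipschitz_iff_lipschitz_on by blast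
  have iff: "is_Lipschitz (L + \<epsilon>) UNIV f \<longleftrightarrow> (L + \<epsilon>)-lipschitz_on UNIV f" for f :: "'a \<Rightarrow> real"
    using assms(1) \<epsilon> by (intro is_Lipschitz_iff_lipschitz_on) simp
  show "\<exists>f :: 'a \<Rightarrow> real. is_Lipschitz (L + \<epsilon>) UNIV f \<and> (\<forall>x\<in>C. f x = g x) \<and>
      (\<forall>x\<in>C. lip_a UNIV f x = lip_a C g x) \<and> (bounded (g ` C) \<longrightarrow> bounded (range f)) \<and>
      (bounded (support_in C g) \<longrightarrow> bounded (support_in UNIV f))"
  proof (cases "bounded (support_in C g)")
    case False
    then show ?thesis
      using lipschitz_extension_preserving_lip_a[OF lip \<epsilon>] by (simp add: iff)
  next
    case True
    \<comment> \<open>One half of \<open>\<epsilon>\<close> is spent on the extension by \<open>0\<close>, the other one on the profiles.\<close>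
    obtain F h where F: "bounded (- F)" "closed F" "(L + \<epsilon> / 2)-lipschitz_on (C \<union> F) h"
      and h: "\<forall>x\<in>C. h x = g x" "\<forall>x\<in>F. h x = 0" "\<forall>x\<in>C. lip_a (C \<union> F) h x = lip_a C g x"
      using extend_by_zero_far_away[OF lip half_gt_zero[OF \<epsilon>] True] by blast
    obtain f where f: "(L + \<epsilon> / 2 + \<epsilon> / 2)-lipschitz_on UNIV f" "\<forall>x\<in>C \<union> F. f x = h x"
      "\<forall>x\<in>C \<union> F. lip_a UNIV f x = lip_a (C \<union> F) h x"
      "bounded (h ` (C \<union> F)) \<longrightarrow> bounded (range f)"
      using lipschitz_extension_preserving_lip_a[OF F(3) half_gt_zero[OF \<epsilon>]] by blast
    have "{x \<in> UNIV. f x \<noteq> 0} \<subseteq> - F"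
      using f(2) h(2) by auto
    then have "support_in UNIV f \<subseteq> closure (- F)"
      unfolding support_in_def by (simp add: closure_mono)
    then have "bounded (support_in UNIV f)"
      using F(1) bounded_closure bounded_subset by blast
    moreover have "bounded (range f)" if "bounded (g ` C)"
    proof -
      have "h ` (C \<union> F) \<subseteq> insert 0 (g ` C)"
        using h(1,2) by auto
      moreover have "bounded (insert 0 (g ` C))"
        using that by simp
      ultimately have "bounded (h ` (C \<union> F))"
        by (rule bounded_subset[rotated])
      then show ?thesis
        using f(4) by simp
    qed
    moreover have "is_Lipschitz (L + \<epsilon>) UNIV f"
      using f(1) unfolding iff by (simp add: add.assoc)
    moreover have "\<forall>x\<in>C. f x = g x" "\<forall>x\<in>C. lip_a UNIV f x = lip_a C g x"
      using f(2,3) h(1,3) by simp_all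
    ultimately show ?thesis
      by blast
  qed
qed

end
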